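(* Let $K_{3,3}$ be the complete bipartite graph on vertex set $[6]$ with parts $\{1,3,6\}$ and $\{2,4,5\}$, i.e. with edges $(1,2),(1,4),(1,5),(2,3),(2,6),(3,4),(3,5),(4,6),(5,6)$. Then the abelian group $H_1(K_{3,3};\mathbb Z)$ contains an element of order $2$ (i.e. it has $\mathbb Z_2$-torsion).
   Context: Let $G$ be a simple graph with vertex set $[n]$; an edge $\{i,j\}$ with $i<j$ is written $(i,j)$, and $E(G)$ is totally ordered lexicographically. For $F\subseteq E(G)$ let $\beta(F)$ be the partition of $[n]$ into the vertex sets of the connected components of $([n],F)$, and $\mathfrak S_{\beta(F)}\subseteq\mathfrak S_n$ the subgroup of permutations mapping each block to itself. For a commutative ring $R$ let $a_F=\sum_{\sigma\in\mathfrak S_{\beta(F)}}\sigma\in R[\mathfrak S_n]$ and $\mathcal M_F=R[\mathfrak S_n]a_F$; for $e\in F$, $\mathcal M_F\subseteq\mathcal M_{F\setminus e}$. The chain complex is $C_i(G;R)=\bigoplus_{|F|=i}\mathcal M_F$ with $d_i(x)=\sum_{e\in F}(-1)^{|\{f\in F: f<e\}|}\iota_{F,F\setminus e}(x)$ for $x\in\mathcal M_F$, $\iota$ the inclusion into the summand $\mathcal M_{F\setminus e}$; $H_i(G;R)=\ker d_i/\operatorname{im}d_{i+1}$ (the $q$-degree zero chromatic symmetric homology). *)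

theory Defs
  imports "HOL-Combinatorics.Permutations"
begin

text \<open>Edges are pairs (i,j) with i<j; vertex set is {1..n}.
 Group ring Z[S_n] (more generally R[S_n]) elements are functions from permutations
 (maps nat => nat permuting {1..n}) to the ring R, vanishing outside S_n.\<close>

type_synonym 'r grelt = "(nat \<Rightarrow> nat) \<Rightarrow> 'r"

definition Sn :: "nat \<Rightarrow> (nat \<Rightarrow> nat) set" where
  "Sn n = {\<sigma>. \<sigma> permutes {1..n}}"

definition gr_elem :: "nat \<Rightarrow> 'r::comm_ring_1 grelt \<Rightarrow> bool" where
  "gr_elem n a \<longleftrightarrow> (\<forall>\<sigma>. \<sigma> \<notin> Sn n \<longrightarrow> a \<sigma> = 0)"

text \<open>Multiplication in R[S_n]: (sum a_s s)(sum b_t t) = sum a_s b_t (s o t).\<close>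
definition gr_mult :: "nat \<Rightarrow> 'r::comm_ring_1 grelt \<Rightarrow> 'r grelt \<Rightarrow> 'r grelt" where
  "gr_mult n a b = (\<lambda>\<tau>. if \<tau> \<in> Sn n then (\<Sum>\<sigma>\<in>Sn n. a \<sigma> * b (inv \<sigma> \<circ> \<tau>)) else 0)"

definition same_comp :: "(nat \<times> nat) set \<Rightarrow> nat \<Rightarrow> nat \<Rightarrow> bool" where
  "same_comp F i j \<longleftrightarrow> (i, j) \<in> (F \<union> F\<inverse>)\<^sup>*"

definition young :: "nat \<Rightarrow> (nat \<times> nat) set \<Rightarrow> (nat \<Rightarrow> nat) set" where
  "young n F = {\<sigma> \<in> Sn n. \<forall>i\<in>{1..n}. same_comp F i (\<sigma> i)}"

definition aF :: "nat \<Rightarrow> (nat \<times> nat) set \<Rightarrow> 'r::comm_ring_1 grelt" where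
  "aF n F = (\<lambda>\<sigma>. if \<sigma> \<in> young n F then 1 else 0)"

definition MF :: "nat \<Rightarrow> (nat \<times> nat) set \<Rightarrow> 'r::comm_ring_1 grelt set" where
  "MF n F = {gr_mult n r (aF n F) | r. gr_elem n r}"

definition lex_less :: "nat \<times> nat \<Rightarrow> nat \<times> nat \<Rightarrow> bool" where
  "lex_less e f \<longleftrightarrow> fst e < fst f \<or> (fst e = fst f \<and> snd e < snd f)"

definition chains :: "nat \<Rightarrow> (nat \<times> nat) set \<Rightarrow> nat \<Rightarrow> ((nat \<times> nat) set \<Rightarrow> 'r::comm_ring_1 grelt) set" where
  "chains n E i = {x. (\<forall>F. x F \<noteq> (\<lambda>_. 0) \<longrightarrow> F \<subseteq> E \<and> card F = i)
                     \<and> (\<forall>F. F \<subseteq> E \<and> card F = i \<longrightarrow> x F \<in> MF n F)}"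

definition bd :: "nat \<Rightarrow> (nat \<times> nat) set \<Rightarrow> nat \<Rightarrow> ((nat \<times> nat) set \<Rightarrow> 'r::comm_ring_1 grelt)
   \<Rightarrow> ((nat \<times> nat) set \<Rightarrow> 'r grelt)" where
  "bd n E i x = (\<lambda>F' \<sigma>. if F' \<subseteq> E \<and> card F' + 1 = i then
      (\<Sum>e\<in>E - F'. (-1) ^ card {f \<in> insert e F'. lex_less f e} * x (insert e F') \<sigma>) else 0)"

definition cycles :: "nat \<Rightarrow> (nat \<times> nat) set \<Rightarrow> nat \<Rightarrow> ((nat \<times> nat) set \<Rightarrow> 'r::comm_ring_1 grelt) set" where
  "cycles n E i = {x \<in> chains n E i. bd n E i x = (\<lambda>_ _. 0)}"

definition boundaries :: "nat \<Rightarrow> (nat \<times> nat) set \<Rightarrow> nat \<Rightarrow> ((nat \<times> nat) set \<Rightarrow> 'r::comm_ring_1 grelt) set" where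
  "boundaries n E i = bd n E (Suc i) ` chains n E (Suc i)"

definition homology_has_order2 :: "'r::comm_ring_1 itself \<Rightarrow> nat \<Rightarrow> (nat \<times> nat) set \<Rightarrow> nat \<Rightarrow> bool" where
  "homology_has_order2 (T :: 'r itself) n E i \<longleftrightarrow>
     (\<exists>x \<in> (cycles n E i :: ((nat \<times> nat) set \<Rightarrow> 'r grelt) set). x \<notin> boundaries n E i \<and>
         (\<lambda>F \<sigma>. 2 * x F \<sigma>) \<in> boundaries n E i)"

definition K33 :: "(nat \<times> nat) set" where
  "K33 = {(1,2),(1,4),(1,5),(2,3),(2,6),(3,4),(3,5),(4,6),(5,6)}"

end

theory Submission
  imports Defs
begin

text \<open>
  Elements of \<open>MF n F\<close> are the functions on \<open>Sn n\<close> that are invariant under right multiplication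
  by the transpositions of the edges in \<open>F\<close>. For a 1-chain \<open>x\<close> consider the integer
  \<open>\<Phi> x\<close>, the sum of \<open>x {(i, j)} \<sigma>\<close> over all edges \<open>(i, j)\<close> and all \<open>\<sigma>\<close> with
  \<open>\<sigma> i = 1\<close> and \<open>\<sigma> j = 2\<close>. For every graph \<open>\<Phi>\<close> is even on boundaries: if \<open>e\<close> and \<open>f\<close> are
  disjoint, right multiplication by the transposition of \<open>f\<close> is a fixed-point-free involution of
  the permutations counted for \<open>e\<close>; if they share a vertex, invariance under the symmetric group
  of the common component makes the sums for \<open>e\<close> and \<open>f\<close> equal.
  For \<open>K33\<close> there is an explicit 2-chain \<open>y\<close>, a sum of 60 cosets, whose boundary is divisible
  by 2 and satisfies \<open>\<Phi> (bd y) = -2\<close>. Hence \<open>x = bd y / 2\<close> is a cycle with \<open>\<Phi> x\<close> odd, so it is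
  not a boundary, whereas \<open>2 x\<close> is.
\<close>

section \<open>Connected components and Young subgroups\<close>

lemma same_comp_refl [simp]: "same_comp F i i"
  by (simp add: same_comp_def)

lemma same_comp_edge: "(i, j) \<in> F \<Longrightarrow> same_comp F i j"
  by (auto simp: same_comp_def)

lemma same_comp_trans: "same_comp F i j \<Longrightarrow> same_comp F j k \<Longrightarrow> same_comp F i k"
  unfolding same_comp_def by (rule rtrancl_trans)

lemma same_comp_sym: "same_comp F i j \<Longrightarrow> same_comp F j i"
  unfolding same_comp_def by (rule symD[OF sym_rtrancl]) (auto simp: sym_def)

lemma same_comp_transpose: "same_comp F i j \<Longrightarrow> same_comp F k (transpose i j k)"
  by (auto simp: transpose_def intro: same_comp_sym)

lemma finite_Sn: "finite (Sn n)"
  by (simp add: Sn_def finite_permutations)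

lemma comp_in_Sn: "\<sigma> \<in> Sn n \<Longrightarrow> \<tau> \<in> Sn n \<Longrightarrow> \<sigma> \<circ> \<tau> \<in> Sn n"
  by (simp add: Sn_def permutes_compose)

lemma inv_in_Sn: "\<sigma> \<in> Sn n \<Longrightarrow> inv \<sigma> \<in> Sn n"
  by (simp add: Sn_def permutes_inv)

lemma transpose_in_Sn: "i \<in> {1..n} \<Longrightarrow> j \<in> {1..n} \<Longrightarrow> transpose i j \<in> Sn n"
  by (simp add: Sn_def permutes_swap_id)

lemma Sn_mem: "\<sigma> \<in> Sn n \<Longrightarrow> i \<in> {1..n} \<Longrightarrow> \<sigma> i \<in> {1..n}"
  unfolding Sn_def using permutes_in_image[of \<sigma> "{1..n}" i] by simp

lemma Sn_inv_comp: "\<sigma> \<in> Sn n \<Longrightarrow> inv \<sigma> \<circ> \<sigma> = id" "\<sigma> \<in> Sn n \<Longrightarrow> \<sigma> \<circ> inv \<sigma> = id"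
  by (auto simp: Sn_def dest: permutes_inv_o)

lemma comp_in_young:
  assumes "\<sigma> \<in> young n F" "\<tau> \<in> young n F"
  shows "\<sigma> \<circ> \<tau> \<in> young n F"
  using assms by (auto simp: young_def intro: comp_in_Sn)
    (metis Sn_mem atLeastAtMost_iff same_comp_trans One_nat_def)

lemma inv_in_young:
  assumes "\<sigma> \<in> young n F"
  shows "inv \<sigma> \<in> young n F"
proof -
  have S: "\<sigma> \<in> Sn n" and c: "\<And>i. i \<in> {1..n} \<Longrightarrow> same_comp F i (\<sigma> i)"
    using assms by (auto simp: young_def)
  have "same_comp F i (inv \<sigma> i)" if "i \<in> {1..n}" for i
    using c[OF Sn_mem[OF inv_in_Sn[OF S] that]] Sn_inv_comp(2)[OF S]
    by (simp add: fun_eq_iff same_comp_sym)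
  then show ?thesis using S by (auto simp: young_def inv_in_Sn)
qed

lemma transpose_in_young:
  "i \<in> {1..n} \<Longrightarrow> j \<in> {1..n} \<Longrightarrow> same_comp F i j \<Longrightarrow> transpose i j \<in> young n F"
  by (auto simp: young_def transpose_in_Sn same_comp_transpose)

section \<open>Right invariance and the modules \<open>MF n F\<close>\<close>

definition transposition_invariant :: "nat \<Rightarrow> (nat \<times> nat) set \<Rightarrow> 'r grelt \<Rightarrow> bool" where
  "transposition_invariant n F z \<longleftrightarrow> (\<forall>(i, j)\<in>F. \<forall>\<sigma>\<in>Sn n. z (\<sigma> \<circ> transpose i j) = z \<sigma>)"

text \<open>Induction along a path from \<open>i\<close> to \<open>j\<close>. Conjugating
  \<open>transpose i j\<close> by the transposition of a further edge from \<open>j\<close> to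
  \<open>k\<close> gives \<open>transpose i k\<close>; the cases in which two of the three vertices
  coincide are immediate.\<close>

lemma transposition_invariant_same_comp:
  assumes F: "F \<subseteq> {1..n} \<times> {1..n}" and inv: "transposition_invariant n F z"
    and "same_comp F i j" "i \<in> {1..n}" "\<sigma> \<in> Sn n"
  shows "z (\<sigma> \<circ> transpose i j) = z \<sigma>"
proof -
  have "(i, j) \<in> (F \<union> F\<inverse>)\<^sup>*" using assms by (simp add: same_comp_def)
  then show ?thesis using \<open>\<sigma> \<in> Sn n\<close>
  proof (induction arbitrary: \<sigma> rule: rtrancl_induct)
    case base
    then show ?case by simp
  next
    case (step j k)
    have jk: "j \<in> {1..n}" "k \<in> {1..n}" using step.hyps(2) F by auto
    have one: "z (\<tau> \<circ> transpose j k) = z \<tau>" if "\<tau> \<in> Sn n" for \<tau>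
      using step.hyps(2) inv that transpose_commute[of j k]
      by (auto simp: transposition_invariant_def)
    consider "i = k" | "i = j" | "j = k" | "i \<noteq> k" "i \<noteq> j" "j \<noteq> k" by blast
    then show ?case
    proof cases
      case 2
      then show ?thesis by (simp only: one[OF step.prems])
    next
      case 4
      have "transpose i k = transpose j k \<circ> transpose i j \<circ> transpose j k"
        using 4 by (auto simp: transpose_def fun_eq_iff)
      then have "z (\<sigma> \<circ> transpose i k) = z (\<sigma> \<circ> transpose j k \<circ> transpose i j \<circ> transpose j k)"
        by (simp add: comp_assoc)
      also have "\<dots> = z (\<sigma> \<circ> transpose j k \<circ> transpose i j)"
        by (intro one comp_in_Sn step.prems transpose_in_Sn jk \<open>i \<in> {1..n}\<close>)
      also have "\<dots> = z (\<sigma> \<circ> transpose j k)"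
        by (intro step.IH comp_in_Sn step.prems transpose_in_Sn jk)
      also have "\<dots> = z \<sigma>" by (rule one[OF step.prems])
      finally show ?thesis .
    qed (use one[OF step.prems] step.IH[OF step.prems] in simp_all)
  qed
qed

text \<open>Transpositions within components generate the Young subgroup. Splitting off
  \<open>transpose a (h a)\<close> from the left of \<open>h\<close> leaves an element that fixes
  \<open>a\<close> and moves no new point, so the number of moved points decreases.\<close>

lemma transposition_invariant_young:
  assumes F: "F \<subseteq> {1..n} \<times> {1..n}" and inv: "transposition_invariant n F z"
    and "h \<in> young n F" "\<sigma> \<in> Sn n"
  shows "z (\<sigma> \<circ> h) = z \<sigma>"
  using assms(3,4)
proof (induction "card {k. h k \<noteq> k}" arbitrary: h \<sigma> rule: less_induct)
  case less
  show ?case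
  proof (cases "h = id")
    case False
    then obtain a where a: "h a \<noteq> a" by (auto simp: fun_eq_iff)
    have hp: "h permutes {1..n}" using less.prems by (simp add: young_def Sn_def)
    have an: "a \<in> {1..n}" using a hp by (meson permutes_not_in)
    have han: "h a \<in> {1..n}" using hp an by (simp only: permutes_in_image)
    have c: "same_comp F a (h a)" using less.prems(1) an by (simp add: young_def)
    define h' where "h' = transpose a (h a) \<circ> h"
    have h': "h' \<in> young n F"
      unfolding h'_def by (intro comp_in_young transpose_in_young an han c less.prems)
    have "{k. h' k \<noteq> k} \<subseteq> {k. h k \<noteq> k} - {a}"
      using permutes_inj[OF hp] a by (auto simp: h'_def transpose_def inj_def)
    moreover have fin: "finite {k. h k \<noteq> k}"
      by (rule finite_subset[of _ "{1..n}"]) (use hp in \<open>auto simp: permutes_def\<close>)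
    ultimately have "card {k. h' k \<noteq> k} < card {k. h k \<noteq> k}"
      using a by (intro psubset_card_mono) auto
    moreover have "\<sigma> \<circ> h = \<sigma> \<circ> transpose a (h a) \<circ> h'"
      by (simp add: h'_def fun_eq_iff)
    ultimately have "z (\<sigma> \<circ> h) = z (\<sigma> \<circ> transpose a (h a))"
      using less.hyps[OF _ h'] comp_in_Sn[OF less.prems(2) transpose_in_Sn[OF an han]] by simp
    also have "\<dots> = z \<sigma>"
      by (rule transposition_invariant_same_comp[OF F inv c an less.prems(2)])
    finally show ?thesis .
  qed simp
qed

text \<open>For the reverse inclusion, pick one representative in each left coset of the Young
  subgroup and restrict \<open>z\<close> to these representatives.\<close>

lemma MF_iff:
  fixes z :: "'r::comm_ring_1 grelt"
  assumes F: "F \<subseteq> {1..n} \<times> {1..n}"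
  shows "z \<in> MF n F \<longleftrightarrow> gr_elem n z \<and> transposition_invariant n F z"
proof (intro iffI conjI)
  assume "z \<in> MF n F"
  then obtain r where z: "z = gr_mult n r (aF n F)" by (auto simp: MF_def)
  show "gr_elem n z" by (simp add: z gr_elem_def gr_mult_def)
  have "z (\<sigma> \<circ> transpose i j) = z \<sigma>" if e: "(i, j) \<in> F" and \<sigma>: "\<sigma> \<in> Sn n" for i j \<sigma>
  proof -
    have ij: "i \<in> {1..n}" "j \<in> {1..n}" using e F by auto
    have t: "transpose i j \<in> young n F" by (intro transpose_in_young ij same_comp_edge e)
    have tS: "\<sigma> \<circ> transpose i j \<in> Sn n" by (intro comp_in_Sn \<sigma> transpose_in_Sn ij)
    have "\<rho> \<circ> transpose i j \<in> young n F \<longleftrightarrow> \<rho> \<in> young n F" for \<rho>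
      using comp_in_young[OF _ t, of \<rho>] comp_in_young[OF _ t, of "\<rho> \<circ> transpose i j"]
      by (auto simp: comp_assoc)
    then show ?thesis by (simp add: z gr_mult_def \<sigma> tS aF_def flip: comp_assoc)
  qed
  then show "transposition_invariant n F z" by (auto simp: transposition_invariant_def)
next
  assume asm: "gr_elem n z \<and> transposition_invariant n F z"
  define coset where "coset \<sigma> = {\<tau> \<in> Sn n. inv \<sigma> \<circ> \<tau> \<in> young n F}" for \<sigma> :: "nat \<Rightarrow> nat"
  define rep where "rep \<sigma> = (SOME \<tau>. \<tau> \<in> coset \<sigma>)" for \<sigma>
  define r where "r \<sigma> = (if \<sigma> \<in> Sn n \<and> \<sigma> = rep \<sigma> then z \<sigma> else 0)" for \<sigma>
  have id: "id \<in> young n F" by (simp add: young_def Sn_def permutes_id)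
  have sym: "\<tau> \<in> coset \<sigma> \<longleftrightarrow> \<sigma> \<in> coset \<tau>" if "\<sigma> \<in> Sn n" "\<tau> \<in> Sn n" for \<sigma> \<tau>
  proof -
    have "inv (inv \<sigma> \<circ> \<tau>) = inv \<tau> \<circ> \<sigma>" if "\<sigma> \<in> Sn n" "\<tau> \<in> Sn n" for \<sigma> \<tau>
      using that o_inv_distrib[OF permutes_bij[OF permutes_inv] permutes_bij, of \<sigma> "{1..n}" \<tau> "{1..n}"]
      by (simp add: Sn_def permutes_inv_inv)
    from this[OF that] this[OF that(2,1)] show ?thesis
      using that by (auto simp: coset_def dest: inv_in_young)
  qed
  have trans: "\<rho> \<in> coset \<sigma>" if "\<tau> \<in> coset \<sigma>" "\<rho> \<in> coset \<tau>" "\<sigma> \<in> Sn n" for \<sigma> \<tau> \<rho>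
  proof -
    have "inv \<sigma> \<circ> \<rho> = (inv \<sigma> \<circ> \<tau>) \<circ> (inv \<tau> \<circ> \<rho>)"
      using that Sn_inv_comp(2)[of \<tau> n] by (simp add: coset_def fun_eq_iff)
    with that show ?thesis by (auto simp: coset_def intro: comp_in_young)
  qed
  have eq: "coset \<sigma> = coset \<tau>" if "\<tau> \<in> coset \<sigma>" "\<sigma> \<in> Sn n" for \<sigma> \<tau>
  proof -
    have "\<tau> \<in> Sn n" using that by (simp add: coset_def)
    then have "\<sigma> \<in> coset \<tau>" using sym that by blast
    then show ?thesis using trans that \<open>\<tau> \<in> Sn n\<close> by blast
  qed
  have rep: "rep \<sigma> \<in> coset \<sigma>" if "\<sigma> \<in> Sn n" for \<sigma>
    unfolding rep_def by (rule someI[of _ \<sigma>]) (simp add: coset_def id that Sn_inv_comp(1)[OF that])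
  have "z \<tau> = gr_mult n r (aF n F) \<tau>" for \<tau>
  proof (cases "\<tau> \<in> Sn n")
    case True
    note \<tau> = rep[OF True]
    have \<tau>': "rep \<tau> \<in> Sn n" using \<tau> by (simp add: coset_def)
    \<comment> \<open>The choice depends only on the coset as a set, so \<open>rep\<close> is
      constant on each coset.\<close>
    have "rep (rep \<tau>) = rep \<tau>" 
      using arg_cong[OF eq[OF \<tau> True], of "\<lambda>C. SOME \<tau>. \<tau> \<in> C"] by (simp add: rep_def)
    \<comment> \<open>Only \<open>rep \<tau>\<close> contributes at \<open>\<tau>\<close>: any other
      \<open>\<sigma>\<close> either lies in another coset, where \<open>aF\<close> vanishes, or is
      not the representative of its own coset, where \<open>r\<close> vanishes.\<close>
    have zero: "r \<sigma> * aF n F (inv \<sigma> \<circ> \<tau>) = 0" if "\<sigma> \<in> Sn n" "\<sigma> \<noteq> rep \<tau>" for \<sigma>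
    proof (cases "\<tau> \<in> coset \<sigma>")
      case True
      then have "rep \<sigma> = rep \<tau>" 
        using arg_cong[OF eq[OF _ that(1)], of \<tau> "\<lambda>C. SOME \<tau>. \<tau> \<in> C"] by (simp add: rep_def)
      then show ?thesis using that by (simp add: r_def)
    next
      case False
      then show ?thesis using \<open>\<tau> \<in> Sn n\<close> by (simp add: coset_def aF_def)
    qed
    have "gr_mult n r (aF n F) \<tau> = (\<Sum>\<sigma>\<in>Sn n. r \<sigma> * aF n F (inv \<sigma> \<circ> \<tau>))"
      using True by (simp add: gr_mult_def)
    also have "\<dots> = (\<Sum>\<sigma>\<in>{rep \<tau>}. r \<sigma> * aF n F (inv \<sigma> \<circ> \<tau>))"
      using zero \<tau>' by (intro sum.mono_neutral_right finite_Sn) auto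
    also have "\<dots> = z (rep \<tau>)"
      using \<tau> \<tau>' sym[OF True \<tau>'] True \<open>rep (rep \<tau>) = rep \<tau>\<close>
      by (simp only: r_def aF_def coset_def mem_Collect_eq sum.insert sum.empty) simp
    also have "\<dots> = z (\<tau> \<circ> (inv \<tau> \<circ> rep \<tau>))"
      using Sn_inv_comp(2)[OF True] by (simp flip: comp_assoc)
    also have "\<dots> = z \<tau>"
      using \<tau> True asm
      by (intro transposition_invariant_young[OF F]) (simp_all only: coset_def mem_Collect_eq)
    finally show ?thesis by simp
  next
    case False
    then show ?thesis using asm by (simp add: gr_mult_def gr_elem_def)
  qed
  then have "z = gr_mult n r (aF n F)" by blast
  moreover have "gr_elem n r" by (simp add: gr_elem_def r_def)
  ultimately show "z \<in> MF n F" by (auto simp: MF_def)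
qed

section \<open>Boundaries: the parity invariant and right invariance\<close>

text \<open>The ordered pairs \<open>(e, f)\<close> and \<open>(f, e)\<close> are grouped together.
  In the application \<open>e\<close> is the edge that remains and \<open>f\<close> the edge deleted
  by the differential.\<close>

lemma even_sum_off_diagonal:
  fixes g :: "'a \<Rightarrow> 'a \<Rightarrow> int"
  assumes "finite E" "\<And>e f. e \<in> E \<Longrightarrow> f \<in> E \<Longrightarrow> e \<noteq> f \<Longrightarrow> even (g e f + g f e)"
  shows "even (\<Sum>e\<in>E. \<Sum>f\<in>E - {e}. g e f)"
  using assms
proof (induction E rule: finite_induct)
  case (insert a E)
  have "(\<Sum>e\<in>insert a E. \<Sum>f\<in>insert a E - {e}. g e f)
      = (\<Sum>f\<in>E. g a f) + (\<Sum>e\<in>E. \<Sum>f\<in>insert a E - {e}. g e f)"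
    using insert by simp
  also have "(\<Sum>e\<in>E. \<Sum>f\<in>insert a E - {e}. g e f) = (\<Sum>e\<in>E. g e a + (\<Sum>f\<in>E - {e}. g e f))"
  proof (rule sum.cong[OF refl])
    fix e assume "e \<in> E"
    then have "insert a E - {e} = insert a (E - {e})" using insert by auto
    then show "(\<Sum>f\<in>insert a E - {e}. g e f) = g e a + (\<Sum>f\<in>E - {e}. g e f)"
      using insert by simp
  qed
  also have "(\<Sum>f\<in>E. g a f) + \<dots> = (\<Sum>f\<in>E. g a f + g f a) + (\<Sum>e\<in>E. \<Sum>f\<in>E - {e}. g e f)"
    by (simp add: sum.distrib)
  finally have *: "(\<Sum>e\<in>insert a E. \<Sum>f\<in>insert a E - {e}. g e f)
      = (\<Sum>f\<in>E. g a f + g f a) + (\<Sum>e\<in>E. \<Sum>f\<in>E - {e}. g e f)" .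
  have "even (\<Sum>f\<in>E. g a f + g f a)"
    using insert.hyps insert.prems[of a] by (intro dvd_sum) blast
  moreover have "even (\<Sum>e\<in>E. \<Sum>f\<in>E - {e}. g e f)"
    using insert.IH insert.prems by blast
  ultimately show ?case unfolding * by simp
qed simp

definition pinned :: "nat \<Rightarrow> nat \<times> nat \<Rightarrow> (nat \<Rightarrow> nat) set" where
  "pinned n e = {\<sigma> \<in> Sn n. \<sigma> (fst e) = 1 \<and> \<sigma> (snd e) = 2}"

text \<open>Only one of the two orders of the values 1 and 2 on each edge is counted. On a 1-chain,
  invariance under the transposition of the edge makes both orders contribute equally, so counting
  both would give an even number always.\<close>

definition pinned_sum :: "nat \<Rightarrow> (nat \<times> nat) set \<Rightarrow> ((nat \<times> nat) set \<Rightarrow> int grelt) \<Rightarrow> int" where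
  "pinned_sum n E x = (\<Sum>e\<in>E. \<Sum>\<sigma>\<in>pinned n e. x {e} \<sigma>)"

text \<open>The Young subgroup contains some \<open>h\<close> with \<open>h i = k\<close> and
  \<open>h j = l\<close>. Right multiplication by \<open>inv h\<close> then carries one set of
  pinned permutations onto the other without changing \<open>z\<close>.\<close>

lemma sum_pinned_eq:
  assumes F: "F \<subseteq> {1..n} \<times> {1..n}" and z: "transposition_invariant n F z"
    and ij: "(i, j) \<in> F" "i \<noteq> j" and kl: "(k, l) \<in> F" "k \<noteq> l" and c: "same_comp F i k"
  shows "sum z (pinned n (i, j)) = sum z (pinned n (k, l))"
proof -
  have mem: "i \<in> {1..n}" "j \<in> {1..n}" "k \<in> {1..n}" "l \<in> {1..n}" using F ij kl by auto
  define t where "t = transpose i k"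
  \<comment> \<open>The right factor moves \<open>j\<close> to \<open>t l\<close> and fixes
    \<open>i\<close>, because \<open>l \<noteq> k\<close> gives \<open>t l \<noteq> i\<close>; then
    \<open>t\<close> sends \<open>i\<close> to \<open>k\<close> and \<open>t l\<close> to
    \<open>l\<close>.\<close>
  define h where "h = t \<circ> transpose j (t l)"
  have tl: "same_comp F l (t l)" unfolding t_def by (rule same_comp_transpose[OF c])
  have "same_comp F i l" using c kl same_comp_edge same_comp_trans by blast
  moreover have "same_comp F j i" using ij same_comp_edge same_comp_sym by blast
  ultimately have jl: "same_comp F j (t l)" using tl same_comp_trans by blast
  have tlm: "t l \<in> {1..n}" unfolding t_def using mem by (auto simp: transpose_def)
  have h: "h \<in> young n F" unfolding h_def t_def
    using c jl tlm mem by (intro comp_in_young transpose_in_young) (auto simp: t_def)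
  have hS: "h \<in> Sn n" using h by (simp add: young_def)
  have hi: "h i = k" "h j = l"
    using ij kl by (auto simp: h_def t_def transpose_def)
  have ih: "inv h k = i" "inv h l = j"
    using hi hS by (auto simp: Sn_def permutes_inv_eq)
  show ?thesis
  proof (rule sum.reindex_bij_witness[of _ "\<lambda>\<sigma>. \<sigma> \<circ> h" "\<lambda>\<sigma>. \<sigma> \<circ> inv h"])
    fix \<sigma> assume "\<sigma> \<in> pinned n (i, j)"
    then have S: "\<sigma> \<in> Sn n" by (simp add: pinned_def)
    show "z (\<sigma> \<circ> inv h) = z \<sigma>"
      by (rule transposition_invariant_young[OF F z inv_in_young[OF h] S])
  qed (use hS ih hi Sn_inv_comp[OF hS] in \<open>auto simp: pinned_def comp_in_Sn inv_in_Sn comp_assoc\<close>)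
qed

lemma even_sum_pinned:
  fixes z :: "int grelt"
  assumes F: "F \<subseteq> {1..n} \<times> {1..n}" and z: "transposition_invariant n F z"
    and kl: "(k, l) \<in> F" "k \<noteq> l" and disj: "{i, j} \<inter> {k, l} = {}"
  shows "even (sum z (pinned n (i, j)))"
proof -
  have t: "transpose k l \<in> Sn n" using F kl by (intro transpose_in_Sn) auto
  \<comment> \<open>Comparing the values at \<open>k\<close> and \<open>l\<close> selects one
    element from each orbit of right multiplication by \<open>transpose k l\<close>. Disjointness of
    the edges keeps the pinned values in place.\<close>
  define A where "A = {\<sigma> \<in> pinned n (i, j). \<sigma> k < \<sigma> l}"
  define B where "B = {\<sigma> \<in> pinned n (i, j). \<sigma> l < \<sigma> k}"
  have fin: "finite (pinned n (i, j))" by (simp add: pinned_def finite_Sn)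
  have "\<sigma> k \<noteq> \<sigma> l" if "\<sigma> \<in> Sn n" for \<sigma>
    using that kl permutes_inj[of \<sigma> "{1..n}"] by (auto simp: Sn_def inj_def)
  then have "\<sigma> k < \<sigma> l \<or> \<sigma> l < \<sigma> k" if "\<sigma> \<in> pinned n (i, j)" for \<sigma>
    using that by (simp add: pinned_def nat_neq_iff[symmetric])
  then have AB: "pinned n (i, j) = A \<union> B" unfolding A_def B_def by blast
  have "finite A" "finite B" "A \<inter> B = {}" using fin by (auto simp: A_def B_def)
  then have "sum z (pinned n (i, j)) = sum z A + sum z B"
    unfolding AB by (rule sum.union_disjoint)
  moreover have "sum z A = sum z B"
  proof (rule sum.reindex_bij_witness[of _ "\<lambda>\<sigma>. \<sigma> \<circ> transpose k l" "\<lambda>\<sigma>. \<sigma> \<circ> transpose k l"])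
    fix \<sigma> assume "\<sigma> \<in> A"
    then show "z (\<sigma> \<circ> transpose k l) = z \<sigma>"
      using z kl by (auto simp: transposition_invariant_def A_def pinned_def)
  qed (use t disj in \<open>auto simp: A_def B_def pinned_def comp_in_Sn comp_assoc\<close>)
  ultimately show ?thesis by simp
qed

lemma even_pinned_sum_bd:
  fixes z :: "(nat \<times> nat) set \<Rightarrow> int grelt"
  assumes E: "E \<subseteq> {1..n} \<times> {1..n}" "\<And>i. (i, i) \<notin> E" and z: "z \<in> chains n E 2"
  shows "even (pinned_sum n E (bd n E 2 z))"
proof -
  have fin: "finite E" by (rule finite_subset[OF E(1)]) simp
  define sgn where "sgn e f = (-1::int) ^ card {g \<in> {f, e}. lex_less g f}" for e f :: "nat \<times> nat"
  \<comment> \<open>This is what the summand of \<open>{e, f}\<close> contributes at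
    \<open>e\<close> when \<open>f\<close> is deleted. Every sign is odd, so only the parity of the
    pinned sum matters.\<close>
  define g where "g e f = sgn e f * sum (z {f, e}) (pinned n e)" for e f
  have odd: "odd (sgn e f)" for e f by (simp add: sgn_def)
  have "pinned_sum n E (bd n E 2 z) = (\<Sum>e\<in>E. \<Sum>\<sigma>\<in>pinned n e. \<Sum>f\<in>E - {e}. sgn e f * z {f, e} \<sigma>)"
    by (simp add: pinned_sum_def bd_def sgn_def)
  also have "\<dots> = (\<Sum>e\<in>E. \<Sum>f\<in>E - {e}. g e f)"
    unfolding g_def sum_distrib_left by (intro sum.cong refl sum.swap)
  also have "even \<dots>"
  proof (rule even_sum_off_diagonal[OF fin])
    fix e f assume ef: "e \<in> E" "f \<in> E" "e \<noteq> f"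
    obtain i j k l where ij: "e = (i, j)" and kl: "f = (k, l)" by (metis surj_pair)
    have ne: "i \<noteq> j" "k \<noteq> l" using ef E(2) ij kl by auto
    let ?F = "{f, e}"
    have F: "?F \<subseteq> {1..n} \<times> {1..n}" using ef E by auto
    have "z ?F \<in> MF n ?F" using z ef by (auto simp: chains_def)
    then have inv: "transposition_invariant n ?F (z ?F)" using MF_iff[OF F] by blast
    have "even (sum (z ?F) (pinned n e)) \<longleftrightarrow> even (sum (z ?F) (pinned n f))"
    proof (cases "{i, j} \<inter> {k, l} = {}")
      case True
      have "even (sum (z ?F) (pinned n e))"
        by (rule even_sum_pinned[OF F inv, of k l i j, folded ij])
          (use True kl ne in auto)
      moreover have "even (sum (z ?F) (pinned n f))"
        by (rule even_sum_pinned[OF F inv, of i j k l, folded kl])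
          (use True ij ne in auto)
      ultimately show ?thesis by simp
    next
      case False
      have "same_comp ?F i j" "same_comp ?F k l"
        by (auto intro!: same_comp_edge simp: ij kl)
      then have "same_comp ?F i k"
        using False by (auto intro: same_comp_sym same_comp_trans)
      then show ?thesis
        using sum_pinned_eq[OF F inv _ ne(1) _ ne(2)] ij kl by simp
    qed
    moreover have "{e, f} = {f, e}" by auto
    ultimately show "even (g e f + g f e)"
      using odd by (simp add: g_def)
  qed
  finally show ?thesis .
qed

text \<open>Each term is invariant under the transpositions of the larger set
  \<open>insert e F\<close>, hence under those of \<open>F\<close>. The conclusion is phrased by
  invariance and not by \<open>MF\<close> because invariance visibly survives halving all
  values.\<close>

lemma bd_transposition_invariant:
  fixes x :: "(nat \<times> nat) set \<Rightarrow> 'r::comm_ring_1 grelt"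
  assumes E: "E \<subseteq> {1..n} \<times> {1..n}" and x: "x \<in> chains n E (Suc i)" and F: "F \<subseteq> E" "card F = i"
  shows "gr_elem n (bd n E (Suc i) x F)" "transposition_invariant n F (bd n E (Suc i) x F)"
proof -
  have fin: "finite F" using E F(1) by (meson finite_SigmaI finite_atLeastAtMost finite_subset)
  have MF: "gr_elem n (x (insert e F)) \<and> transposition_invariant n (insert e F) (x (insert e F))"
    if "e \<in> E - F" for e
  proof -
    have "insert e F \<subseteq> E" "card (insert e F) = Suc i" using that F fin by auto
    then show ?thesis using x E MF_iff[of "insert e F" n "x (insert e F)"]
      by (auto simp: chains_def)
  qed
  show "gr_elem n (bd n E (Suc i) x F)"
    using MF by (auto simp: gr_elem_def bd_def intro!: sum.neutral)
  show "transposition_invariant n F (bd n E (Suc i) x F)"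
    using MF by (force simp: transposition_invariant_def bd_def intro!: sum.cong)
qed

section \<open>One-line notation of permutations\<close>

text \<open>Words carry a leading entry \<open>0\<close>, so that \<open>word n \<sigma> ! i = \<sigma> i\<close> without an index shift.\<close>

abbreviation word :: "nat \<Rightarrow> (nat \<Rightarrow> nat) \<Rightarrow> nat list" where
  "word n \<sigma> \<equiv> map \<sigma> [0..<Suc n]"

definition swap_entries :: "nat \<times> nat \<Rightarrow> 'a list \<Rightarrow> 'a list" where
  "swap_entries e w = w[fst e := w ! snd e, snd e := w ! fst e]"

lemma swap_entries_swap_entries:
  "fst e < length w \<Longrightarrow> snd e < length w \<Longrightarrow> swap_entries e (swap_entries e w) = w"
  by (rule nth_equalityI) (auto simp: swap_entries_def nth_list_update)

lemma word_comp_transpose: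
  assumes "i \<le> n" "j \<le> n"
  shows "word n (\<sigma> \<circ> transpose i j) = swap_entries (i, j) (word n \<sigma>)"
  using assms
  by (intro nth_equalityI)
    (auto simp: swap_entries_def nth_list_update transpose_def less_Suc_eq_le simp del: upt_Suc)

lemma inj_on_word: "inj_on (word n) (Sn n)"
proof (rule inj_onI)
  fix \<sigma> \<tau> assume st: "\<sigma> \<in> Sn n" "\<tau> \<in> Sn n" and "word n \<sigma> = word n \<tau>"
  then have "\<sigma> k = \<tau> k" if "k \<le> n" for k using that by (auto simp: map_eq_conv)
  moreover have "\<sigma> k = \<tau> k" if "\<not> k \<le> n" for k
    using that st permutes_not_in[of \<sigma> "{1..n}" k] permutes_not_in[of \<tau> "{1..n}" k]
    by (simp add: Sn_def)
  ultimately show "\<sigma> = \<tau>" by blast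
qed

text \<open>Sorting gives a test for permutations that can be evaluated on concrete lists.\<close>

definition is_word :: "nat \<Rightarrow> nat list \<Rightarrow> bool" where
  "is_word n w \<longleftrightarrow> hd w = 0 \<and> sort w = [0..<Suc n]"

lemma is_word_imp_word:
  assumes "is_word n w"
  obtains \<sigma> where "\<sigma> \<in> Sn n" "word n \<sigma> = w"
proof -
  define \<sigma> where "\<sigma> k = (if k \<le> n then w ! k else k)" for k
  have m: "mset w = mset [0..<Suc n]" using assms by (metis is_word_def mset_sort)
  have len: "length w = Suc n" using mset_eq_length[OF m] by simp
  have dist: "distinct w" using mset_eq_imp_distinct_iff[OF m] by simp
  have set: "set w = {0..n}" using mset_eq_setD[OF m] by (simp add: atLeastLessThanSuc_atLeastAtMost del: upt_Suc)
  have "w ! 0 = 0" using assms len by (cases w) (auto simp: is_word_def)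
  have "{0..n} = {..<length w}" using len by auto
  then have bij: "bij_betw (\<lambda>k. w ! k) {0..n} {0..n}"
    by (rule bij_betw_nth[OF dist]) (rule set[symmetric])
  \<comment> \<open>Removing the fixed index 0 turns the bijection of \<open>{0..n}\<close> into one
    of \<open>{1..n}\<close>.\<close>
  have "bij_betw (\<lambda>k. w ! k) {0} {0}" using \<open>w ! 0 = 0\<close> by (simp add: bij_betw_def)
  from bij_betw_DiffI[OF bij this] have "bij_betw (\<lambda>k. w ! k) ({0..n} - {0}) ({0..n} - {0})" by simp
  moreover have "{0..n} - {0} = {1..n}" by auto
  ultimately have "bij_betw (\<lambda>k. w ! k) {1..n} {1..n}" by (simp only:)
  moreover have "bij_betw \<sigma> {1..n} {1..n} = bij_betw (\<lambda>k. w ! k) {1..n} {1..n}"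
    by (rule bij_betw_cong) (simp add: \<sigma>_def)
  ultimately have "bij_betw \<sigma> {1..n} {1..n}" by (simp only:)
  then have "\<sigma> permutes {1..n}"
    using \<open>w ! 0 = 0\<close> by (intro bij_imp_permutes) (auto simp: \<sigma>_def not_less_eq_eq)
  moreover have "word n \<sigma> = w"
    using len by (intro nth_equalityI) (auto simp: \<sigma>_def simp del: upt_Suc)
  ultimately show thesis using that by (simp add: Sn_def)
qed

section \<open>Two-chains given by lists of cosets\<close>

text \<open>A triple \<open>(e, f, ws)\<close> encodes an element of the summand indexed by \<open>{e, f}\<close>: the sum of a
  left coset of the Young subgroup, whose elements have the words \<open>ws\<close>.\<close>

definition valid_coset ::
  "nat \<Rightarrow> (nat \<times> nat) set \<Rightarrow> (nat \<times> nat) \<times> (nat \<times> nat) \<times> nat list list \<Rightarrow> bool" where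
  "valid_coset n E = (\<lambda>(e, f, ws). e \<in> E \<and> f \<in> E \<and> lex_less e f \<and> distinct ws \<and>
     list_all (\<lambda>w. is_word n w \<and> swap_entries e w \<in> set ws \<and> swap_entries f w \<in> set ws) ws)"

definition coset_chain ::
  "nat \<Rightarrow> ((nat \<times> nat) \<times> (nat \<times> nat) \<times> nat list list) list \<Rightarrow> (nat \<times> nat) set \<Rightarrow> int grelt" where
  "coset_chain n T F \<sigma> = (\<Sum>(e, f, ws)\<leftarrow>T. of_bool (F = {e, f} \<and> \<sigma> \<in> Sn n \<and> word n \<sigma> \<in> set ws))"

text \<open>The words that reach the summand of \<open>{g}\<close> under the differential, with
  multiplicity but without sign; this is enough modulo 2.\<close>

definition words_at ::
  "(nat \<times> nat) \<Rightarrow> ((nat \<times> nat) \<times> (nat \<times> nat) \<times> nat list list) list \<Rightarrow> nat list list" where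
  "words_at g T = concat (map (\<lambda>(e, f, ws). if g = e \<or> g = f then ws else []) T)"

definition pinned_words :: "nat \<times> nat \<Rightarrow> nat list list \<Rightarrow> int" where
  "pinned_words e ws = int (length (filter (\<lambda>w. w ! fst e = 1 \<and> w ! snd e = 2) ws))"

lemma sum_list_swap_sum:
  fixes h :: "'a \<Rightarrow> 'b \<Rightarrow> 'c::comm_monoid_add"
  shows "(\<Sum>a\<in>A. \<Sum>t\<leftarrow>T. h a t) = (\<Sum>t\<leftarrow>T. \<Sum>a\<in>A. h a t)"
  by (induction T) (auto simp: sum.distrib)

lemma lex_less_irrefl: "\<not> lex_less e e"
  by (simp add: lex_less_def)

lemma lex_less_asym: "lex_less e f \<Longrightarrow> \<not> lex_less f e"
  by (auto simp: lex_less_def)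

text \<open>Here \<open>h\<close> is the deleted edge and \<open>g\<close> the remaining one. Since
  \<open>e\<close> precedes \<open>f\<close>, deleting \<open>e\<close> has sign +1 and leaves
  \<open>f\<close>, while deleting \<open>f\<close> has sign -1 and leaves \<open>e\<close>.\<close>

lemma sum_pair_signs:
  assumes fin: "finite E" and e: "e \<in> E" and f: "f \<in> E" and ef: "lex_less e f" and g: "g \<in> E"
  shows "(\<Sum>h\<in>E - {g}. (-1::int) ^ card {k \<in> {h, g}. lex_less k h} * of_bool ({h, g} = {e, f}))
    = of_bool (g = f) - of_bool (g = e)"
proof -
  let ?t = "\<lambda>h. (-1::int) ^ card {k \<in> {h, g}. lex_less k h} * of_bool ({h, g} = {e, f})"
  have ne: "e \<noteq> f" using ef lex_less_irrefl by blast
  consider "g = f" | "g = e" | "g \<noteq> e" "g \<noteq> f" by blast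
  then show ?thesis
  proof cases
    case 1
    have sum: "(\<Sum>h\<in>E - {g}. ?t h) = (\<Sum>h\<in>{e}. ?t h)"
      using 1 ne e fin by (intro sum.mono_neutral_right) (auto simp: doubleton_eq_iff)
    have none: "{k \<in> {e, g}. lex_less k e} = {}"
      using 1 lex_less_irrefl[of e] lex_less_asym[OF ef] by auto
    have t: "(\<Sum>h\<in>{e}. ?t h) = 1"
      using 1 none
      by (simp only: sum.insert finite.emptyI empty_iff not_False_eq_True sum.empty none) simp
    show ?thesis unfolding sum t using 1 ne by simp
  next
    case 2
    have sum: "(\<Sum>h\<in>E - {g}. ?t h) = (\<Sum>h\<in>{f}. ?t h)"
      using 2 ne f fin by (intro sum.mono_neutral_right) (auto simp: doubleton_eq_iff)
    have one: "{k \<in> {f, g}. lex_less k f} = {e}"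
      using 2 ef lex_less_irrefl[of f] by auto
    have t: "(\<Sum>h\<in>{f}. ?t h) = -1"
      using 2 one
      by (simp only: sum.insert finite.emptyI empty_iff not_False_eq_True sum.empty one)
        (simp add: insert_commute)
    show ?thesis unfolding sum t using 2 ne by simp
  next
    case 3
    then show ?thesis by (auto simp: doubleton_eq_iff)
  qed
qed

lemma bd_coset_chain:
  assumes fin: "finite E" and T: "list_all (valid_coset n E) T" and g: "g \<in> E"
  shows "bd n E 2 (coset_chain n T) {g} \<sigma> =
    (\<Sum>(e, f, ws)\<leftarrow>T. (of_bool (g = f) - of_bool (g = e)) * of_bool (\<sigma> \<in> Sn n \<and> word n \<sigma> \<in> set ws))"
proof -
  let ?s = "\<lambda>h. (-1::int) ^ card {k \<in> {h, g}. lex_less k h}"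
  have "bd n E 2 (coset_chain n T) {g} \<sigma> = (\<Sum>h\<in>E - {g}. \<Sum>(e, f, ws)\<leftarrow>T.
      ?s h * of_bool ({h, g} = {e, f}) * of_bool (\<sigma> \<in> Sn n \<and> word n \<sigma> \<in> set ws))"
    using g by (simp add: bd_def coset_chain_def sum_list_const_mult[symmetric] case_prod_unfold
      of_bool_conj mult.assoc del: upt_Suc)
  also have "\<dots> = (\<Sum>(e, f, ws)\<leftarrow>T. \<Sum>h\<in>E - {g}.
      ?s h * of_bool ({h, g} = {e, f}) * of_bool (\<sigma> \<in> Sn n \<and> word n \<sigma> \<in> set ws))"
    by (simp add: sum_list_swap_sum case_prod_unfold del: upt_Suc)
  also have "\<dots> = (\<Sum>(e, f, ws)\<leftarrow>T.
      (of_bool (g = f) - of_bool (g = e)) * of_bool (\<sigma> \<in> Sn n \<and> word n \<sigma> \<in> set ws))"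
  proof (intro arg_cong[where f = sum_list] map_cong refl, clarify)
    fix e f ws assume "(e, f, ws) \<in> set T"
    then have "e \<in> E" "f \<in> E" "lex_less e f"
      using T by (auto simp: list_all_iff valid_coset_def)
    then show "(\<Sum>h\<in>E - {g}. ?s h * of_bool ({h, g} = {e, f})
          * of_bool (\<sigma> \<in> Sn n \<and> word n \<sigma> \<in> set ws)) =
        (of_bool (g = f) - of_bool (g = e)) * of_bool (\<sigma> \<in> Sn n \<and> word n \<sigma> \<in> set ws)"
      using sum_pair_signs[OF fin _ _ _ g, of e f] by (simp only: sum_distrib_right[symmetric])
  qed
  finally show ?thesis .
qed

lemma coset_chain_in_chains:
  assumes E: "E \<subseteq> {1..n} \<times> {1..n}" and T: "list_all (valid_coset n E) T"
  shows "coset_chain n T \<in> chains n E 2"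
proof -
  have supp: "F \<subseteq> E \<and> card F = 2" if "coset_chain n T F \<noteq> (\<lambda>_. 0)" for F
  proof (rule ccontr)
    assume F: "\<not> (F \<subseteq> E \<and> card F = 2)"
    have "F \<noteq> {e, f}" if "(e, f, ws) \<in> set T" for e f ws
    proof -
      have "e \<in> E" "f \<in> E" "e \<noteq> f"
        using T that lex_less_irrefl[of e] by (auto simp: list_all_iff valid_coset_def)
      then show ?thesis using F by (metis card_2_iff empty_subsetI insert_subset)
    qed
    then have "coset_chain n T F \<sigma> = (\<Sum>c\<leftarrow>T. 0)" for \<sigma>
      unfolding coset_chain_def by (intro arg_cong[where f = sum_list] map_cong) auto
    then show False using that by auto
  qed
  moreover have "coset_chain n T F \<in> MF n F" if F: "F \<subseteq> E" for F
  proof -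
    have "gr_elem n (coset_chain n T F)"
      by (auto simp: gr_elem_def coset_chain_def case_prod_unfold)
    moreover have "coset_chain n T F (\<sigma> \<circ> transpose i j) = coset_chain n T F \<sigma>"
      if ij: "(i, j) \<in> F" and \<sigma>: "\<sigma> \<in> Sn n" for i j \<sigma>
    proof -
      have mem: "i \<in> {1..n}" "j \<in> {1..n}" using ij F E by auto
      have S: "\<sigma> \<circ> transpose i j \<in> Sn n" by (intro comp_in_Sn \<sigma> transpose_in_Sn mem)
      have "word n (\<sigma> \<circ> transpose i j) \<in> set ws \<longleftrightarrow> word n \<sigma> \<in> set ws"
        if "(e, f, ws) \<in> set T" "F = {e, f}" for e f ws
      proof -
        have closed: "swap_entries (i, j) w \<in> set ws" if "w \<in> set ws" for w
          using T that ij \<open>(e, f, ws) \<in> set T\<close> \<open>F = {e, f}\<close> by (auto simp: list_all_iff valid_coset_def)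
        have w: "word n (\<sigma> \<circ> transpose i j) = swap_entries (i, j) (word n \<sigma>)"
          using mem by (intro word_comp_transpose) auto
        \<comment> \<open>Closure under the swap gives one implication; the converse follows because
          the swap is an involution.\<close>
        have "swap_entries (i, j) (swap_entries (i, j) (word n \<sigma>)) = word n \<sigma>"
          using mem by (intro swap_entries_swap_entries) auto
        then show ?thesis unfolding w using closed by metis
      qed
      then show ?thesis unfolding coset_chain_def using S \<sigma>
        by (intro arg_cong[where f = sum_list] map_cong refl) (auto simp del: upt_Suc)
    qed
    ultimately show ?thesis
      using F E by (subst MF_iff) (auto simp: transposition_invariant_def)
  qed
  ultimately show ?thesis by (auto simp: chains_def)
qed

text \<open>Modulo 2 the coefficient of a permutation at \<open>{g}\<close> is the multiplicity of
  its word in \<open>words_at g T\<close>. Words that do not occur have multiplicity 0, so it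
  suffices to test those that do.\<close>

lemma even_bd_coset_chain:
  assumes fin: "finite E" and T: "list_all (valid_coset n E) T"
    and even: "\<forall>g\<in>E. list_all (\<lambda>w. even (count_list (words_at g T) w)) (words_at g T)"
  shows "even (bd n E 2 (coset_chain n T) F \<sigma>)"
proof (cases "F \<subseteq> E \<and> card F = 1 \<and> \<sigma> \<in> Sn n")
  case True
  then obtain g where F: "F = {g}" and g: "g \<in> E" and \<sigma>: "\<sigma> \<in> Sn n" by (auto simp: card_1_singleton_iff)
  define u where "u = word n \<sigma>"
  have "even (\<Sum>(e, f, ws)\<leftarrow>T. (of_bool (g = f) - of_bool (g = e)) * (of_bool (u \<in> set ws) :: int))
      \<longleftrightarrow> even (count_list (words_at g T) u)"
    using T
  proof (induction T)
    case Nil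
    then show ?case by (simp add: words_at_def)
  next
    case (Cons c T)
    obtain e f ws where c: "c = (e, f, ws)" by (metis surj_pair)
    have ne: "e \<noteq> f" and d: "distinct ws"
      using Cons.prems lex_less_irrefl[of e] by (auto simp: c valid_coset_def)
    have "count_list ws u = of_bool (u \<in> set ws)"
      using d by (induction ws) auto
    then show ?case using Cons ne by (auto simp: words_at_def c)
  qed
  moreover have "even (count_list (words_at g T) u)"
    using even g by (cases "u \<in> set (words_at g T)") (auto simp: list_all_iff)
  ultimately show ?thesis
    unfolding F bd_coset_chain[OF fin T g] using \<sigma> by (simp add: u_def)
next
  case False
  have "coset_chain n T A \<sigma> = 0" if "\<sigma> \<notin> Sn n" for A
    using that by (simp add: coset_chain_def case_prod_unfold)
  with False show ?thesis by (auto simp: bd_def)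
qed

text \<open>Passing to words is injective on \<open>Sn n\<close>, and every valid word comes from a
  permutation, so a sum over permutations becomes a count on the given list.\<close>

lemma sum_pinned_of_bool:
  assumes ws: "distinct ws" "list_all (is_word n) ws" and e: "fst e \<le> n" "snd e \<le> n"
  shows "(\<Sum>\<sigma>\<in>pinned n e. of_bool (\<sigma> \<in> Sn n \<and> word n \<sigma> \<in> set ws)) = pinned_words e ws"
proof -
  have "(\<Sum>\<sigma>\<in>pinned n e. of_bool (\<sigma> \<in> Sn n \<and> word n \<sigma> \<in> set ws)) =
      int (card {\<sigma> \<in> pinned n e. word n \<sigma> \<in> set ws})"
    by (subst sum_of_bool_eq) (auto simp: pinned_def finite_Sn Int_def intro!: arg_cong[where f = card])
  also have "card {\<sigma> \<in> pinned n e. word n \<sigma> \<in> set ws} =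
      card (word n ` {\<sigma> \<in> pinned n e. word n \<sigma> \<in> set ws})"
    by (intro card_image[symmetric] inj_on_subset[OF inj_on_word]) (auto simp: pinned_def)
  also have "word n ` {\<sigma> \<in> pinned n e. word n \<sigma> \<in> set ws}
      = set (filter (\<lambda>w. w ! fst e = 1 \<and> w ! snd e = 2) ws)" (is "?A = ?B")
  proof
    show "?A \<subseteq> ?B" using e by (auto simp: pinned_def simp del: upt_Suc)
    show "?B \<subseteq> ?A"
    proof
      fix w assume w: "w \<in> ?B"
      then obtain \<sigma> where "\<sigma> \<in> Sn n" "word n \<sigma> = w"
        using ws(2) is_word_imp_word[of n w] by (auto simp: list_all_iff)
      then show "w \<in> ?A" using w e by (force simp: pinned_def simp del: upt_Suc)
    qed
  qed
  also have "card \<dots> = length (filter (\<lambda>w. w ! fst e = 1 \<and> w ! snd e = 2) ws)"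
    using ws(1) by (intro distinct_card) simp
  finally show ?thesis by (simp add: pinned_words_def)
qed

lemma pinned_sum_bd_coset_chain:
  assumes E: "E \<subseteq> {1..n} \<times> {1..n}" and T: "list_all (valid_coset n E) T"
  shows "pinned_sum n E (bd n E 2 (coset_chain n T)) =
    (\<Sum>(e, f, ws)\<leftarrow>T. pinned_words f ws - pinned_words e ws)"
proof -
  have fin: "finite E" by (rule finite_subset[OF E]) simp
  have "pinned_sum n E (bd n E 2 (coset_chain n T)) = (\<Sum>g\<in>E. \<Sum>\<sigma>\<in>pinned n g. \<Sum>(e, f, ws)\<leftarrow>T.
      (of_bool (g = f) - of_bool (g = e)) * of_bool (\<sigma> \<in> Sn n \<and> word n \<sigma> \<in> set ws))"
    unfolding pinned_sum_def using bd_coset_chain[OF fin T] by simp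
  also have "\<dots> = (\<Sum>(e, f, ws)\<leftarrow>T. \<Sum>g\<in>E. (of_bool (g = f) - of_bool (g = e)) *
      (\<Sum>\<sigma>\<in>pinned n g. of_bool (\<sigma> \<in> Sn n \<and> word n \<sigma> \<in> set ws)))"
    by (simp add: sum_list_swap_sum case_prod_unfold sum_distrib_left del: upt_Suc)
  also have "\<dots> = (\<Sum>(e, f, ws)\<leftarrow>T. pinned_words f ws - pinned_words e ws)"
  proof (intro arg_cong[where f = sum_list] map_cong refl, clarify)
    fix e f ws assume "(e, f, ws) \<in> set T"
    then have c: "e \<in> E" "f \<in> E" "distinct ws" "list_all (is_word n) ws"
      using T by (auto simp: list_all_iff valid_coset_def)
    have "(\<Sum>\<sigma>\<in>pinned n g. of_bool (\<sigma> \<in> Sn n \<and> word n \<sigma> \<in> set ws)) = pinned_words g ws"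
      if "g \<in> E" for g
      using E that by (intro sum_pinned_of_bool c) auto
    then have "(\<Sum>g\<in>E. (of_bool (g = f) - of_bool (g = e)) *
        (\<Sum>\<sigma>\<in>pinned n g. of_bool (\<sigma> \<in> Sn n \<and> word n \<sigma> \<in> set ws)))
      = (\<Sum>g\<in>E. (if g = f then pinned_words g ws else 0) - (if g = e then pinned_words g ws else 0))"
      by (intro sum.cong refl) auto
    also have "\<dots> = pinned_words f ws - pinned_words e ws"
      using c fin by (simp add: sum_subtractf)
    finally show "(\<Sum>g\<in>E. (of_bool (g = f) - of_bool (g = e)) *
        (\<Sum>\<sigma>\<in>pinned n g. of_bool (\<sigma> \<in> Sn n \<and> word n \<sigma> \<in> set ws)))
      = pinned_words f ws - pinned_words e ws" .
  qed
  finally show ?thesis .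
qed

section \<open>Cycles in degree one\<close>

lemma bd_1_eq_sum:
  assumes "finite E"
  shows "bd n E 1 x F \<sigma> = (if F = {} then \<Sum>e\<in>E. x {e} \<sigma> else 0)"
proof -
  \<comment> \<open>A single edge has no predecessor, so its sign is +1.\<close>
  have none: "{f \<in> insert e {}. lex_less f e} = {}" for e
    using lex_less_irrefl[of e] by auto
  show ?thesis
  proof (cases "F = {}")
    case True
    show ?thesis unfolding bd_def True by (simp only: none card.empty) simp
  next
    case False
    then have "\<not> (F \<subseteq> E \<and> card F = 0)" using assms by (auto dest: finite_subset)
    then show ?thesis using False by (auto simp: bd_def)
  qed
qed

text \<open>The relation \<open>d_1 d_2 = 0\<close> for an encoded chain: each coset occurs once at
  \<open>f\<close> with sign +1 and once at \<open>e\<close> with sign -1.\<close>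

lemma sum_bd_coset_chain:
  assumes "finite E" and T: "list_all (valid_coset n E) T"
  shows "(\<Sum>g\<in>E. bd n E 2 (coset_chain n T) {g} \<sigma>) = 0"
proof -
  have "(\<Sum>g\<in>E. bd n E 2 (coset_chain n T) {g} \<sigma>) = (\<Sum>(e, f, ws)\<leftarrow>T.
      (\<Sum>g\<in>E. of_bool (g = f) - of_bool (g = e)) * of_bool (\<sigma> \<in> Sn n \<and> word n \<sigma> \<in> set ws))"
    using bd_coset_chain[OF assms]
    by (simp add: sum_list_swap_sum case_prod_unfold sum_distrib_right del: upt_Suc)
  also have "\<dots> = (\<Sum>c\<leftarrow>T. 0)"
  proof (intro arg_cong[where f = sum_list] map_cong refl, clarify)
    fix e f ws assume "(e, f, ws) \<in> set T"
    then have "e \<in> E" "f \<in> E" using T by (auto simp: list_all_iff valid_coset_def)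
    then show "(\<Sum>g\<in>E. of_bool (g = f) - of_bool (g = e)) * of_bool (\<sigma> \<in> Sn n \<and> word n \<sigma> \<in> set ws) = (0::int)"
      using assms(1) by (simp add: sum_subtractf of_bool_def)
  qed
  finally show ?thesis by simp
qed

section \<open>The explicit 2-chain for \<open>K33\<close>\<close>

text \<open>If \<open>e\<close> and \<open>f\<close> are disjoint, only four of the six words are distinct.\<close>

definition coset_words :: "nat \<times> nat \<Rightarrow> nat \<times> nat \<Rightarrow> nat list \<Rightarrow> nat list list" where
  "coset_words e f w = (let s = swap_entries e; t = swap_entries f in
     remdups [w, s w, t w, s (t w), t (s w), s (t (s w))])"

text \<open>Found by computer search: a cycle modulo 2 on which half the pinned sum of the boundary is odd,
  shortened by adding boundaries and cycles supported on 4-cycles of the graph.\<close>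

definition coset_representatives :: "((nat \<times> nat) \<times> (nat \<times> nat) \<times> nat list list) list" where
  "coset_representatives = [
    ((1,2), (3,4), [[0,1,4,2,6,3,5], [0,1,4,3,5,2,6]]),
    ((1,2), (3,5), [[0,1,4,2,3,5,6], [0,1,4,3,2,6,5]]),
    ((1,2), (4,6), [[0,1,4,2,3,5,6], [0,1,4,3,2,6,5]]),
    ((1,2), (5,6), [[0,1,4,2,6,3,5], [0,1,4,3,5,2,6]]),
    ((1,4), (2,3), [[0,1,2,6,4,3,5], [0,1,3,5,4,2,6]]),
    ((1,4), (2,6), [[0,1,2,5,4,6,3], [0,1,5,3,4,2,6]]),
    ((1,4), (3,5), [[0,1,2,5,4,6,3], [0,1,6,2,4,3,5]]),
    ((1,4), (5,6), [[0,1,2,6,4,3,5], [0,1,3,5,4,2,6]]),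
    ((1,5), (2,3), [[0,1,2,5,3,4,6], [0,1,3,6,2,4,5]]),
    ((1,5), (2,6), [[0,1,2,6,5,4,3], [0,1,5,2,3,4,6]]),
    ((1,5), (3,4), [[0,1,2,5,6,4,3], [0,1,6,2,3,4,5]]),
    ((1,5), (4,6), [[0,1,2,5,3,4,6], [0,1,3,6,2,4,5]]),
    ((2,3), (3,4), [[0,1,2,4,6,3,5], [0,1,3,4,5,2,6], [0,4,1,2,6,3,5], [0,4,1,3,5,2,6]]),
    ((2,3), (3,5), [[0,1,2,4,3,5,6], [0,1,3,4,2,6,5], [0,4,1,2,3,5,6], [0,4,1,3,2,6,5]]),
    ((2,3), (4,6), [[0,1,2,4,3,5,6], [0,1,3,4,2,6,5], [0,4,1,2,3,5,6], [0,4,1,3,2,6,5]]),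
    ((2,3), (5,6), [[0,1,2,4,6,3,5], [0,1,3,4,5,2,6], [0,4,1,2,6,3,5], [0,4,1,3,5,2,6]]),
    ((2,6), (3,4), [[0,1,2,4,5,6,3], [0,1,5,3,4,2,6], [0,4,2,1,5,6,3], [0,4,5,1,3,2,6]]),
    ((2,6), (3,5), [[0,1,2,4,5,6,3], [0,1,5,2,3,4,6], [0,4,2,1,5,6,3], [0,4,5,1,3,2,6]]),
    ((3,4), (3,5), [[0,1,2,4,5,6,3], [0,1,6,2,3,4,5], [0,4,2,1,5,6,3], [0,4,6,1,2,3,5]]),
    ((3,4), (5,6), [[0,1,2,4,6,3,5], [0,1,3,4,5,2,6], [0,4,2,1,6,3,5], [0,4,3,1,5,2,6]]),
    ((3,5), (4,6), [[0,1,2,4,3,5,6], [0,1,3,4,2,6,5], [0,4,2,1,3,5,6], [0,4,3,1,2,6,5]])]"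

definition coset_list :: "((nat \<times> nat) \<times> (nat \<times> nat) \<times> nat list list) list" where
  "coset_list = [(e, f, coset_words e f w). (e, f, ws) \<leftarrow> coset_representatives, w \<leftarrow> ws]"

lemma valid_coset_list: "list_all (valid_coset 6 K33) coset_list"
  by code_simp

lemma even_words_at_coset_list:
  "\<forall>g\<in>K33. list_all (\<lambda>w. even (count_list (words_at g coset_list) w)) (words_at g coset_list)"
proof -
  have "list_all (\<lambda>us. list_all (\<lambda>w. even (count_list us w)) us) (map (\<lambda>g. words_at g coset_list)
    [(1,2),(1,4),(1,5),(2,3),(2,6),(3,4),(3,5),(4,6),(5,6)])"
    by code_simp
  then show ?thesis by (simp add: K33_def)
qed

lemma pinned_words_coset_list:
  "(\<Sum>(e, f, ws)\<leftarrow>coset_list. pinned_words f ws - pinned_words e ws) = -2"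
  by code_simp

section \<open>The homology class of order 2\<close>

theorem theorem4p2:
  shows "homology_has_order2 TYPE(int) 6 K33 1"
proof -
  have E: "K33 \<subseteq> {1..6} \<times> {1..6}" "\<And>i. (i, i) \<notin> K33" and fin: "finite K33"
    by (auto simp: K33_def)
  define y where "y = coset_chain 6 coset_list"
  \<comment> \<open>The division is exact, as \<open>x2\<close> records; it yields an integral chain
    whose double is the boundary of \<open>y\<close>.\<close>
  define x where "x F \<sigma> = bd 6 K33 2 y F \<sigma> div 2" for F \<sigma>
  have y: "y \<in> chains 6 K33 2"
    unfolding y_def by (rule coset_chain_in_chains[OF E(1) valid_coset_list])
  have x2: "2 * x F \<sigma> = bd 6 K33 2 y F \<sigma>" for F \<sigma>
    using even_bd_coset_chain[OF fin valid_coset_list even_words_at_coset_list]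
    by (simp add: x_def y_def)
  have "x \<in> chains 6 K33 1"
  proof -
    have "F \<subseteq> K33 \<and> card F = 1" if "x F \<noteq> (\<lambda>_. 0)" for F
      using that by (auto simp: x_def bd_def fun_eq_iff split: if_splits)
    moreover have "x F \<in> MF 6 F" if "F \<subseteq> K33" "card F = 1" for F
    proof -
      have y': "y \<in> chains 6 K33 (Suc 1)" using y by (simp add: numeral_2_eq_2)
      show ?thesis
        using bd_transposition_invariant[OF E(1) y' that] that E(1)
        by (subst MF_iff) (auto simp: x_def[abs_def] gr_elem_def transposition_invariant_def numeral_2_eq_2)
    qed
    ultimately show ?thesis by (auto simp: chains_def)
  qed
  moreover have "bd 6 K33 1 x = (\<lambda>_ _. 0)"
  proof (intro ext)
    fix F \<sigma>
    \<comment> \<open>The integers have no 2-torsion, so the cycle condition for \<open>x\<close>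
      follows from that for the boundary of \<open>y\<close>.\<close>
    have "2 * (\<Sum>e\<in>K33. x {e} \<sigma>) = 0"
      using sum_bd_coset_chain[OF fin valid_coset_list] by (simp add: sum_distrib_left x2 y_def)
    then show "bd 6 K33 1 x F \<sigma> = 0" unfolding bd_1_eq_sum[OF fin] by simp
  qed
  ultimately have "x \<in> cycles 6 K33 1" by (simp add: cycles_def)
  moreover have "x \<notin> boundaries 6 K33 1"
  proof
    assume "x \<in> boundaries 6 K33 1"
    then obtain z where "z \<in> chains 6 K33 2" "x = bd 6 K33 2 z"
      by (auto simp: boundaries_def numeral_2_eq_2)
    then have "even (pinned_sum 6 K33 x)" using even_pinned_sum_bd[OF E] by blast
    \<comment> \<open>The boundary of \<open>y\<close> has pinned sum -2, and \<open>x\<close> is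
      half of it.\<close>
    moreover have "2 * pinned_sum 6 K33 x = 2 * (-1)"
      using pinned_sum_bd_coset_chain[OF E(1) valid_coset_list] pinned_words_coset_list
      by (simp add: pinned_sum_def sum_distrib_left x2 y_def)
    then have "pinned_sum 6 K33 x = -1" by linarith
    ultimately show False by simp
  qed
  moreover have "(\<lambda>F \<sigma>. 2 * x F \<sigma>) \<in> boundaries 6 K33 1"
    using y by (auto simp: boundaries_def x2 numeral_2_eq_2)
  ultimately show ?thesis by (auto simp: homology_has_order2_def)
qed

end
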